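(* Let $G\curvearrowright X$ be a continuous isometric action by an amenable topological group $G$ on a metric space $X$ and assume that the linear operator $R:(\mathfrak{Lip}(X))^G\to\mathrm{Hom}(G,\mathbb{R})$ has finite rank, where $$(R\phi)(g)=\text{the constant value of }\phi-\phi(g\,\cdot\,).$$ Then $$\{\phi\in\mathfrak{Lip}(X)\mid\phi\text{ is constant on every orbit of }G\curvearrowright X\}$$ is complemented in $\mathfrak{Lip}(X)$.
   Context: A topological group $G$ is amenable if every continuous affine action of $G$ on a non-empty compact convex subset of a locally convex topological vector space has a fixed point. Equivalently, there is a mean $\mathfrak m$ (positive linear functional of norm $1$ with $\mathfrak m(\mathbf 1)=1$) on the algebra $\mathsf{LUCB}(G)$ of bounded functions $\phi:G\to\mathbb R$ for which $g\mapsto\phi(\,\cdot\,g)$ is continuous in the sup norm, such that $\mathfrak m(\phi(\,\cdot\, g))=\mathfrak m(\phi)$ for all $g\in G$. For a metric space $X$, $\mathfrak{Lip}(X)=\mathsf{Lip}(X)/\{\text{constant functions}\}$, where $\mathsf{Lip}(X)$ is the space of real-valued Lipschitz functions on $X$; it is a Banach space under the norm $L(\phi)=\sup_{x\ne y}|\phi(x)-\phi(y)|/d(x,y)$. Elements are identified with representatives in $\mathsf{Lip}(X)$. The group $G$ acts on $\mathfrak{Lip}(X)$ by $g\cdot\phi=\phi(g^{-1}\,\cdot\,)$, and the space of invariant elements is $$(\mathfrak{Lip}(X))^G=\{\phi\in\mathfrak{Lip}(X)\mid\text{for all }g\in G,\ \phi-\phi(g\,\cdot\,)\text{ is a constant function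 on }X\}.$$ $\mathrm{Hom}(G,\mathbb{R})$ is the vector space of continuous homomorphisms $G\to\mathbb{R}$; for $\phi\in(\mathfrak{Lip}(X))^G$ the map $R\phi$ is indeed such a homomorphism. A closed subspace is complemented if it is the range of a bounded linear projection. *)

theory Defs
  imports "HOL-Analysis.Analysis"
begin

definition Lip :: "('x::metric_space \<Rightarrow> real) set" where
  "Lip = {f. \<exists>C. C-lipschitz_on UNIV f}"

definition lip_rel :: "('x::metric_space \<Rightarrow> real) \<Rightarrow> ('x \<Rightarrow> real) \<Rightarrow> bool" where
  "lip_rel f h \<longleftrightarrow> f \<in> Lip \<and> h \<in> Lip \<and> (\<exists>c. \<forall>x. f x - h x = c)"

text \<open>The difference quotient at \<open>x = y\<close> is \<open>0 / 0 = 0\<close>, so including the diagonal does not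
  change the supremum over \<open>x \<noteq> y\<close>; it only makes the supremum \<open>0\<close> on a one-point space.\<close>

definition lip_const :: "('x::metric_space \<Rightarrow> real) \<Rightarrow> real" where
  "lip_const f = (SUP (x, y)\<in>UNIV. \<bar>f x - f y\<bar> / dist x y)"

lemma LipI: "(\<And>x y. \<bar>f x - f y\<bar> \<le> C * dist x y) \<Longrightarrow> f \<in> Lip" for f :: "'x::metric_space \<Rightarrow> real"
proof -
  assume *: "\<And>x y. \<bar>f x - f y\<bar> \<le> C * dist x y"
  have "\<bar>f x - f y\<bar> \<le> \<bar>C\<bar> * dist x y" for x y
    by (rule order_trans[OF *]) (simp add: mult_right_mono)
  then have "\<bar>C\<bar>-lipschitz_on UNIV f"
    by (auto simp: lipschitz_on_def dist_real_def)
  then show ?thesis by (auto simp: Lip_def)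
qed

lemma LipE:
  assumes "f \<in> Lip"
  obtains C where "C \<ge> 0" "\<And>x y. \<bar>f x - f y\<bar> \<le> C * dist x y"
proof -
  from assms obtain C where "C \<ge> 0" "\<And>x y. \<bar>f x - f y\<bar> \<le> C * dist x y"
    by (auto simp: Lip_def lipschitz_on_def dist_real_def)
  then show thesis by (rule that)
qed

lemma Lip_const [simp]: "(\<lambda>_. c) \<in> Lip"
  by (rule LipI[where C = 0]) simp

lemma Lip_add: "f \<in> Lip \<Longrightarrow> h \<in> Lip \<Longrightarrow> (\<lambda>x. f x + h x) \<in> Lip"
  unfolding Lip_def by (auto intro: lipschitz_on_add)

lemma Lip_cmult:
  assumes "f \<in> Lip"
  shows "(\<lambda>x. c * f x) \<in> Lip"
proof -
  from assms obtain C where "C \<ge> 0" and C: "\<And>x y. \<bar>f x - f y\<bar> \<le> C * dist x y"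
    by (rule LipE) blast
  show ?thesis
  proof (rule LipI[where C = "\<bar>c\<bar> * C"])
    fix x y
    have "\<bar>c * f x - c * f y\<bar> = \<bar>c\<bar> * \<bar>f x - f y\<bar>"
      by (metis abs_mult right_diff_distrib)
    also have "\<dots> \<le> \<bar>c\<bar> * (C * dist x y)" by (rule mult_left_mono[OF C]) simp
    finally show "\<bar>c * f x - c * f y\<bar> \<le> \<bar>c\<bar> * C * dist x y" by simp
  qed
qed

lemma Lip_uminus: "f \<in> Lip \<Longrightarrow> (\<lambda>x. - f x) \<in> Lip"
  using Lip_cmult[of f "-1"] by simp

lemma Lip_diff: "f \<in> Lip \<Longrightarrow> h \<in> Lip \<Longrightarrow> (\<lambda>x. f x - h x) \<in> Lip"
  using Lip_add[of f "\<lambda>x. - h x"] Lip_uminus[of h] by simp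

lemma lip_const_bdd:
  assumes "f \<in> Lip"
  shows "bdd_above (range (\<lambda>(x, y). \<bar>f x - f y\<bar> / dist x y))"
proof -
  from assms obtain C where C: "C \<ge> 0" "\<And>x y. \<bar>f x - f y\<bar> \<le> C * dist x y"
    by (rule LipE) blast
  have "\<bar>f x - f y\<bar> / dist x y \<le> C" for x y
    using C by (cases "x = y") (auto simp: divide_simps)
  then show ?thesis by (intro bdd_aboveI[of _ C]) auto
qed

lemma lip_const_upper:
  assumes "f \<in> Lip"
  shows "\<bar>f x - f y\<bar> \<le> lip_const f * dist x y"
proof (cases "x = y")
  case False
  have "\<bar>f x - f y\<bar> / dist x y \<le> lip_const f"
    using cSUP_upper[OF UNIV_I lip_const_bdd[OF assms], of "(x, y)"]
    by (simp add: lip_const_def)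
  with False show ?thesis by (simp add: divide_simps)
qed simp

lemma lip_const_least:
  assumes "C \<ge> 0" "\<And>x y. \<bar>f x - f y\<bar> \<le> C * dist x y"
  shows "lip_const f \<le> C"
  unfolding lip_const_def
proof (rule cSUP_least, simp, clarify)
  fix x y
  show "\<bar>f x - f y\<bar> / dist x y \<le> C"
    using assms by (cases "x = y") (auto simp: divide_simps)
qed

lemma lip_const_nonneg: "f \<in> Lip \<Longrightarrow> 0 \<le> lip_const f"
  using cSUP_upper[OF UNIV_I lip_const_bdd, of f "(undefined, undefined)"]
  by (simp add: lip_const_def)

lemma lip_const_eq0: "f \<in> Lip \<Longrightarrow> lip_const f = 0 \<longleftrightarrow> (\<forall>x y. f x = f y)"
proof
  assume "f \<in> Lip" "lip_const f = 0"
  then show "\<forall>x y. f x = f y" using lip_const_upper[of f] by simp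
next
  assume "f \<in> Lip" "\<forall>x y. f x = f y"
  then show "lip_const f = 0"
    using lip_const_least[of 0 f] lip_const_nonneg[of f] by fastforce
qed

lemma lip_const_triangle:
  assumes "f \<in> Lip" "h \<in> Lip"
  shows "lip_const (\<lambda>x. f x + h x) \<le> lip_const f + lip_const h"
proof (rule lip_const_least)
  show "0 \<le> lip_const f + lip_const h" using assms by (simp add: lip_const_nonneg)
  fix x y
  show "\<bar>f x + h x - (f y + h y)\<bar> \<le> (lip_const f + lip_const h) * dist x y"
    using lip_const_upper[OF assms(1), of x y] lip_const_upper[OF assms(2), of x y]
    by (simp add: algebra_simps)
qed

lemma lip_const_cmult_le:
  assumes "f \<in> Lip"
  shows "lip_const (\<lambda>x. c * f x) \<le> \<bar>c\<bar> * lip_const f"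
proof (rule lip_const_least)
  show "0 \<le> \<bar>c\<bar> * lip_const f" using assms by (simp add: lip_const_nonneg)
  fix x y
  have "\<bar>c * f x - c * f y\<bar> = \<bar>c\<bar> * \<bar>f x - f y\<bar>"
    by (metis abs_mult right_diff_distrib)
  also have "\<dots> \<le> \<bar>c\<bar> * (lip_const f * dist x y)"
    by (rule mult_left_mono[OF lip_const_upper[OF assms]]) simp
  finally show "\<bar>c * f x - c * f y\<bar> \<le> \<bar>c\<bar> * lip_const f * dist x y" by simp
qed

lemma lip_const_cmult:
  assumes "f \<in> Lip"
  shows "lip_const (\<lambda>x. c * f x) = \<bar>c\<bar> * lip_const f"
proof (cases "c = 0")
  case True
  then show ?thesis by (simp add: lip_const_eq0)
next
  case False
  have "lip_const (\<lambda>x. inverse c * (c * f x)) \<le> \<bar>inverse c\<bar> * lip_const (\<lambda>x. c * f x)"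
    by (rule lip_const_cmult_le[OF Lip_cmult[OF assms]])
  with False have "\<bar>c\<bar> * lip_const f \<le> lip_const (\<lambda>x. c * f x)"
    by (simp add: field_simps)
  with lip_const_cmult_le[OF assms, of c] show ?thesis by simp
qed

quotient_type (overloaded) 'x lip_mod = "'x::metric_space \<Rightarrow> real" / partial: lip_rel
proof (rule part_equivpI)
  show "\<exists>f. lip_rel f (f :: 'x \<Rightarrow> real)"
    by (rule exI[of _ "\<lambda>_. 0"]) (simp add: lip_rel_def)
  show "symp (lip_rel :: ('x \<Rightarrow> real) \<Rightarrow> _)"
  proof (rule sympI)
    fix f h :: "'x \<Rightarrow> real"
    assume "lip_rel f h"
    then obtain c where "f \<in> Lip" "h \<in> Lip" "\<And>x. f x - h x = c" by (auto simp: lip_rel_def)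
    then show "lip_rel h f"
      unfolding lip_rel_def by (metis minus_diff_eq)
  qed
  show "transp (lip_rel :: ('x \<Rightarrow> real) \<Rightarrow> _)"
  proof (rule transpI)
    fix f h k :: "'x \<Rightarrow> real"
    assume "lip_rel f h" "lip_rel h k"
    then obtain c d where "f \<in> Lip" "k \<in> Lip" "\<And>x. f x - h x = c" "\<And>x. h x - k x = d"
      by (auto simp: lip_rel_def)
    then show "lip_rel f k"
      unfolding lip_rel_def by (intro conjI exI[of _ "c + d"]) (auto simp: algebra_simps)
  qed
qed

instantiation lip_mod :: (metric_space) real_normed_vector
begin

lift_definition zero_lip_mod :: "'a lip_mod" is "\<lambda>_. 0"
  by (simp add: lip_rel_def)

lift_definition plus_lip_mod :: "'a lip_mod \<Rightarrow> 'a lip_mod \<Rightarrow> 'a lip_mod" is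
  "\<lambda>f h x. f x + h x"
proof -
  fix f h k l :: "'a \<Rightarrow> real"
  assume "lip_rel f h" "lip_rel k l"
  then obtain c d where "f \<in> Lip" "h \<in> Lip" "k \<in> Lip" "l \<in> Lip"
    and c: "\<And>x. f x - h x = c" and d: "\<And>x. k x - l x = d"
    by (auto simp: lip_rel_def)
  moreover have "f x + k x - (h x + l x) = c + d" for x using c[of x] d[of x] by linarith
  ultimately show "lip_rel (\<lambda>x. f x + k x) (\<lambda>x. h x + l x)"
    by (auto simp: lip_rel_def Lip_add)
qed

lift_definition uminus_lip_mod :: "'a lip_mod \<Rightarrow> 'a lip_mod" is "\<lambda>f x. - f x"
  unfolding lip_rel_def by (metis Lip_uminus minus_diff_minus)

lift_definition minus_lip_mod :: "'a lip_mod \<Rightarrow> 'a lip_mod \<Rightarrow> 'a lip_mod" is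
  "\<lambda>f h x. f x - h x"
proof -
  fix f h k l :: "'a \<Rightarrow> real"
  assume "lip_rel f h" "lip_rel k l"
  then obtain c d where "f \<in> Lip" "h \<in> Lip" "k \<in> Lip" "l \<in> Lip"
    and c: "\<And>x. f x - h x = c" and d: "\<And>x. k x - l x = d"
    by (auto simp: lip_rel_def)
  moreover have "f x - k x - (h x - l x) = c - d" for x using c[of x] d[of x] by linarith
  ultimately show "lip_rel (\<lambda>x. f x - k x) (\<lambda>x. h x - l x)"
    by (auto simp: lip_rel_def Lip_diff)
qed

lift_definition scaleR_lip_mod :: "real \<Rightarrow> 'a lip_mod \<Rightarrow> 'a lip_mod" is "\<lambda>r f x. r * f x"
  unfolding lip_rel_def by (metis Lip_cmult right_diff_distrib)

lift_definition norm_lip_mod :: "'a lip_mod \<Rightarrow> real" is lip_const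
proof -
  fix f h :: "'a \<Rightarrow> real"
  assume "lip_rel f h"
  then obtain c where c: "\<And>x. f x - h x = c" by (auto simp: lip_rel_def)
  have "f x - f y = h x - h y" for x y using c[of x] c[of y] by simp
  then show "lip_const f = lip_const h" by (simp add: lip_const_def)
qed

definition dist_lip_mod :: "'a lip_mod \<Rightarrow> 'a lip_mod \<Rightarrow> real" where
  "dist_lip_mod a b = norm (a - b)"

definition sgn_lip_mod :: "'a lip_mod \<Rightarrow> 'a lip_mod" where
  "sgn_lip_mod a = scaleR (inverse (norm a)) a"

definition uniformity_lip_mod :: "('a lip_mod \<times> 'a lip_mod) filter" where
  "uniformity_lip_mod = (INF e\<in>{0<..}. principal {(a, b). dist a b < e})"

definition open_lip_mod :: "'a lip_mod set \<Rightarrow> bool" where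
  "open_lip_mod U \<longleftrightarrow> (\<forall>a\<in>U. \<forall>\<^sub>F (a', b) in uniformity. a' = a \<longrightarrow> b \<in> U)"

instance
proof
  fix a b c :: "'a lip_mod" and r s :: real
  show "a + b + c = a + (b + c)"
    by transfer (auto simp: lip_rel_def Lip_add)
  show "a + b = b + a"
    by transfer (auto simp: lip_rel_def Lip_add)
  show "0 + a = a"
    by transfer (auto simp: lip_rel_def)
  show "- a + a = 0"
    by transfer (auto simp: lip_rel_def)
  show "a - b = a + - b"
    by transfer (auto simp: lip_rel_def Lip_diff)
  show "r *\<^sub>R (a + b) = r *\<^sub>R a + r *\<^sub>R b"
    by transfer (auto simp: lip_rel_def Lip_add Lip_cmult distrib_left)
  show "(r + s) *\<^sub>R a = r *\<^sub>R a + s *\<^sub>R a"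
    by transfer (auto simp: lip_rel_def Lip_add Lip_cmult distrib_right)
  show "r *\<^sub>R s *\<^sub>R a = (r * s) *\<^sub>R a"
    by transfer (simp add: lip_rel_def Lip_cmult mult.assoc)
  show "1 *\<^sub>R a = a"
    by transfer (auto simp: lip_rel_def)
  show "dist a b = norm (a - b)" by (rule dist_lip_mod_def)
  show "sgn a = scaleR (inverse (norm a)) a" by (rule sgn_lip_mod_def)
  show "uniformity = (INF e\<in>{0<..}. principal {(a, b :: 'a lip_mod). dist a b < e})"
    by (rule uniformity_lip_mod_def)
  show "open U \<longleftrightarrow> (\<forall>a\<in>U. \<forall>\<^sub>F (a', b) in uniformity. a' = a \<longrightarrow> b \<in> U)" for U :: "'a lip_mod set"
    by (rule open_lip_mod_def)
  show "norm a = 0 \<longleftrightarrow> a = 0"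
  proof transfer
    fix f :: "'a \<Rightarrow> real"
    assume "lip_rel f f"
    then have f: "f \<in> Lip" by (simp add: lip_rel_def)
    then show "lip_const f = 0 \<longleftrightarrow> lip_rel f (\<lambda>_. 0)"
      by (simp add: lip_const_eq0 lip_rel_def) metis
  qed
  show "norm (a + b) \<le> norm a + norm b"
    by transfer (simp add: lip_rel_def lip_const_triangle)
  show "norm (r *\<^sub>R a) = \<bar>r\<bar> * norm a"
    by transfer (simp add: lip_rel_def lip_const_cmult)
qed

end

text \<open>Groups are written additively, since \<open>topological_group_add\<close> is the library's class of
  (not necessarily commutative, not necessarily Hausdorff) topological groups. The product
  \<open>g h\<close> is \<open>g + h\<close>.\<close>

text \<open>\<open>uniform_limit UNIV\<close> expresses continuity of \<open>g \<mapsto> \<phi>(\<cdot> g)\<close> with respect to the sup norm.\<close>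

definition LUCB :: "('g::topological_group_add \<Rightarrow> real) set" where
  "LUCB = {\<phi>. bounded (range \<phi>) \<and>
     (\<forall>g. uniform_limit UNIV (\<lambda>h x. \<phi> (x + h)) (\<lambda>x. \<phi> (x + g)) (at g))}"

text \<open>Together with \<open>m 1 = 1\<close>, the bound by the sup norm says that \<open>m\<close> has norm exactly \<open>1\<close>.
  Values of \<open>m\<close> outside \<open>LUCB\<close> are irrelevant.\<close>

definition mean :: "(('g::topological_group_add \<Rightarrow> real) \<Rightarrow> real) \<Rightarrow> bool" where
  "mean m \<longleftrightarrow>
     (\<forall>\<phi>\<in>LUCB. \<forall>\<psi>\<in>LUCB. m (\<lambda>x. \<phi> x + \<psi> x) = m \<phi> + m \<psi>) \<and>
     (\<forall>c. \<forall>\<phi>\<in>LUCB. m (\<lambda>x. c * \<phi> x) = c * m \<phi>) \<and>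
     (\<forall>\<phi>\<in>LUCB. (\<forall>x. 0 \<le> \<phi> x) \<longrightarrow> 0 \<le> m \<phi>) \<and>
     (\<forall>\<phi>\<in>LUCB. \<bar>m \<phi>\<bar> \<le> (SUP x. \<bar>\<phi> x\<bar>)) \<and>
     m (\<lambda>_. 1) = 1"

definition amenable :: "'g::topological_group_add itself \<Rightarrow> bool" where
  "amenable _ \<longleftrightarrow>
     (\<exists>m :: ('g \<Rightarrow> real) \<Rightarrow> real. mean m \<and> (\<forall>g. \<forall>\<phi>\<in>LUCB. m (\<lambda>x. \<phi> (x + g)) = m \<phi>))"

definition isometric_action :: "('g::topological_group_add \<Rightarrow> 'x::metric_space \<Rightarrow> 'x) \<Rightarrow> bool" where
  "isometric_action act \<longleftrightarrow>
     (\<forall>x. act 0 x = x) \<and>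
     (\<forall>g h x. act (g + h) x = act g (act h x)) \<and>
     (\<forall>g x y. dist (act g x) (act g y) = dist x y)"

definition continuous_action :: "('g::topological_group_add \<Rightarrow> 'x::metric_space \<Rightarrow> 'x) \<Rightarrow> bool" where
  "continuous_action act \<longleftrightarrow> continuous_on UNIV (\<lambda>(g, x). act g x)"

definition orbit_of :: "('g \<Rightarrow> 'x \<Rightarrow> 'x) \<Rightarrow> 'x \<Rightarrow> 'x set" where
  "orbit_of act x = range (\<lambda>g. act g x)"

lift_definition lip_invariant :: "('g \<Rightarrow> 'x::metric_space \<Rightarrow> 'x) \<Rightarrow> 'x lip_mod \<Rightarrow> bool" is
  "\<lambda>act \<phi>. \<forall>g. \<exists>c. \<forall>x. \<phi> x - \<phi> (act g x) = c"
proof -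
  fix act :: "'g \<Rightarrow> 'x \<Rightarrow> 'x" and f h :: "'x \<Rightarrow> real"
  assume "lip_rel f h"
  then obtain c where c: "\<And>x. f x - h x = c" by (auto simp: lip_rel_def)
  have "f x - f y = h x - h y" for x y using c[of x] c[of y] by simp
  then show "(\<forall>g. \<exists>c. \<forall>x. f x - f (act g x) = c) = (\<forall>g. \<exists>c. \<forall>x. h x - h (act g x) = c)"
    by simp
qed

lift_definition constant_on_orbits :: "('g \<Rightarrow> 'x::metric_space \<Rightarrow> 'x) \<Rightarrow> 'x lip_mod \<Rightarrow> bool" is
  "\<lambda>act \<phi>. \<forall>x. \<phi> constant_on (orbit_of act x)"
proof -
  fix act :: "'g \<Rightarrow> 'x \<Rightarrow> 'x" and f h :: "'x \<Rightarrow> real"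
  assume "lip_rel f h"
  then obtain c where c: "\<And>x. f x - h x = c" by (auto simp: lip_rel_def)
  have f: "f x = h x + c" for x using c[of x] by simp
  have "f constant_on A \<longleftrightarrow> h constant_on A" for A
    unfolding constant_on_def f by (metis add_right_cancel)
  then show "(\<forall>x. f constant_on (orbit_of act x)) = (\<forall>x. h constant_on (orbit_of act x))"
    by simp
qed

text \<open>\<open>lip_R act \<phi> g\<close> is meaningful only for \<open>\<phi>\<close> satisfying \<open>lip_invariant act\<close>.\<close>

lift_definition lip_R :: "('g \<Rightarrow> 'x::metric_space \<Rightarrow> 'x) \<Rightarrow> 'x lip_mod \<Rightarrow> 'g \<Rightarrow> real" is
  "\<lambda>act \<phi> g. THE c. \<forall>x. \<phi> x - \<phi> (act g x) = c"
proof -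
  fix act :: "'g \<Rightarrow> 'x \<Rightarrow> 'x" and f h :: "'x \<Rightarrow> real"
  assume "lip_rel f h"
  then obtain c where c: "\<And>x. f x - h x = c" by (auto simp: lip_rel_def)
  have "f x - f y = h x - h y" for x y using c[of x] c[of y] by simp
  then show "(\<lambda>g. THE c. \<forall>x. f x - f (act g x) = c) = (\<lambda>g. THE c. \<forall>x. h x - h (act g x) = c)"
    by simp
qed

definition Hom_real :: "('g::topological_group_add \<Rightarrow> real) set" where
  "Hom_real = {u. continuous_on UNIV u \<and> (\<forall>g h. u (g + h) = u g + u h)}"

text \<open>Finite rank of a linear map \<open>T\<close> from \<open>V\<close> into a space \<open>W\<close> of real-valued functions (with
  pointwise operations): the range is contained in the linear span of a finite subset of \<open>W\<close>.\<close>

definition finite_rank :: "'v set \<Rightarrow> ('g \<Rightarrow> real) set \<Rightarrow> ('v \<Rightarrow> 'g \<Rightarrow> real) \<Rightarrow> bool" where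
  "finite_rank V W T \<longleftrightarrow>
     (\<exists>B. finite B \<and> B \<subseteq> W \<and> (\<forall>v\<in>V. \<exists>a. \<forall>g. T v g = (\<Sum>b\<in>B. a b * b g)))"

definition complemented :: "'v::real_normed_vector set \<Rightarrow> bool" where
  "complemented S \<longleftrightarrow> subspace S \<and> closed S \<and>
     (\<exists>P. bounded_linear P \<and> (\<forall>v. P (P v) = P v) \<and> range P = S)"

lemma lip_R_eqI:
  assumes "lip_rel f f" "\<And>x. f x - f (act g x) = c"
  shows "lip_R act (abs_lip_mod f) g = c"
  using assms by (simp add: lip_R.abs_eq)

lemma lip_R_in_Hom:
  fixes act :: "'g::topological_group_add \<Rightarrow> 'x::metric_space \<Rightarrow> 'x"
  assumes act: "isometric_action act" "continuous_action act"
    and inv: "lip_invariant act \<phi>"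
  shows "lip_R act \<phi> \<in> Hom_real"
proof -
  obtain f where f: "\<phi> = abs_lip_mod f" "lip_rel f f"
    by (metis Quotient3_lip_mod Quotient3_abs_rep Quotient3_rep_reflp)
  have Lf: "f \<in> Lip" using f by (simp add: lip_rel_def)
  have "\<forall>g. \<exists>c. \<forall>x. f x - f (act g x) = c"
    using inv f by (simp add: lip_invariant.abs_eq)
  then obtain r where r: "\<And>g x. f x - f (act g x) = r g" by metis
  have R: "lip_R act \<phi> = r"
    using r by (auto simp: f(1) intro: lip_R_eqI[OF f(2)])
  have "continuous_on UNIV f"
    using Lf by (auto simp: Lip_def intro: lipschitz_on_continuous_on)
  moreover have "continuous_on UNIV ((\<lambda>(g, x). act g x) \<circ> (\<lambda>g. (g, undefined)))"
    using act(2) unfolding continuous_action_def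
    by (intro continuous_on_compose continuous_intros) (auto intro: continuous_on_subset)
  ultimately have "continuous_on UNIV (\<lambda>g. f undefined - f (act g undefined))"
    by (intro continuous_intros) (auto simp: o_def intro: continuous_on_compose2)
  then have "continuous_on UNIV r" by (simp add: r)
  moreover have "r (g + h) = r g + r h" for g h
  proof -
    have "f (act (g + h) undefined) = f (act g (act h undefined))"
      using act(1) by (simp add: isometric_action_def)
    then show ?thesis
      using r[of undefined "g + h"] r[of "act h undefined" g] r[of undefined h] by linarith
  qed
  ultimately show ?thesis by (simp add: R Hom_real_def)
qed

end

theory Submission
  imports Defs
begin

text \<open>Fix a base point \<open>z\<close>. For \<open>\<phi>\<close> Lipschitz, \<open>g \<mapsto> \<phi>(g x) - \<phi>(g z)\<close> is in \<open>LUCB\<close>, and averaging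
  it over \<open>g\<close> with an invariant mean gives a function of \<open>x\<close>; this is a norm one projection of the
  Lipschitz functions modulo constants onto the invariant elements. On the range of
  this projection, \<open>R\<close> is given by the bounded functionals \<open>\<phi> \<mapsto> \<phi>(z) - \<phi>(g z)\<close>, and as \<open>R\<close> has
  finite rank its kernel, which consists of the functions constant on orbits, is reached by cutting
  down with finitely many of these functionals, one rank one correction of the projection at
  a time.\<close>

section \<open>Cutting down the range of a projection\<close>

text \<open>The range of an idempotent is its set of fixed points, so continuity makes it closed and
  linearity makes it a subspace.\<close>

lemma complemented_projection:
  assumes "bounded_linear P" "\<And>v. P (P v) = P v" "range P = S"
  shows "complemented S"
proof -
  interpret P: bounded_linear P by fact
  have "S = {v. P v = v}"
    unfolding assms(3)[symmetric] by (auto simp: assms(2) intro: sym)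
  moreover have "closed {v. P v = v}"
    by (intro closed_Collect_eq P.continuous_on continuous_on_id)
  moreover have "subspace S"
    unfolding assms(3)[symmetric] by (intro linear_subspace_image P.linear subspace_UNIV)
  ultimately show ?thesis
    using assms by (auto simp: complemented_def)
qed

text \<open>Subtracting from \<open>P v\<close> the multiple of \<open>u\<close> on which
  \<open>F\<close> has the same value keeps it in \<open>S\<close>, makes \<open>F\<close> vanish,
  and changes nothing where \<open>F\<close> is already zero on \<open>S\<close>.\<close>

lemma complemented_kernel_functional:
  fixes F :: "'v::real_normed_vector \<Rightarrow> real"
  assumes S: "complemented S" and F: "bounded_linear F" and u: "u \<in> S" "F u \<noteq> 0"
  shows "complemented {v \<in> S. F v = 0}"
proof -
  from S obtain P where P: "bounded_linear P" "\<And>v. P (P v) = P v" "range P = S"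
    by (auto simp: complemented_def)
  have PS: "P v = v" if "v \<in> S" for v
    using that P(2) unfolding P(3)[symmetric] by auto
  define Q where "Q v = P v - (F (P v) / F u) *\<^sub>R u" for v
  have Q_bl: "bounded_linear Q"
  proof -
    have *: "bounded_linear (\<lambda>v. F (P v))"
      by (rule bounded_linear_compose[OF F P(1)])
    show ?thesis
      unfolding Q_def
      by (intro bounded_linear_sub P(1) bounded_linear_scaleR_const bounded_linear_divide
            bounded_linear_compose[OF bounded_linear_divide *])
  qed
  have FQ: "F (Q v) = 0" for v
    using u(2) by (simp add: Q_def linear_diff linear_scale bounded_linear.linear[OF F])
  have QS: "Q v \<in> S" for v
    using S P(3) u(1) unfolding complemented_def Q_def
    by (auto intro!: subspace_diff subspace_scale)
  have Qid: "Q v = v" if "v \<in> S" "F v = 0" for v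
    using that PS by (simp add: Q_def)
  have "range Q = {v \<in> S. F v = 0}"
    using FQ QS by (auto intro: range_eqI Qid[symmetric])
  then show ?thesis
    by (intro complemented_projection[OF Q_bl]) (simp_all add: Qid QS FQ)
qed

text \<open>Each functional \<open>F h\<close> that is not zero on \<open>S\<close> can be imposed
  by a rank one correction, and doing so removes one of the spanning functions \<open>b i\<close>;
  hence finitely many corrections suffice. The coefficients \<open>a\<close> depend on
  \<open>v\<close> in no prescribed way.\<close>

lemma complemented_common_kernel:
  fixes F :: "'g \<Rightarrow> 'v::real_normed_vector \<Rightarrow> real" and b :: "'i \<Rightarrow> 'g \<Rightarrow> real"
  assumes "finite I" "complemented S" "\<And>g. bounded_linear (F g)"
    and "\<And>v. v \<in> S \<Longrightarrow> \<exists>a. \<forall>g. F g v = (\<Sum>i\<in>I. a i * b i g)"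
  shows "complemented {v \<in> S. \<forall>g. F g v = 0}"
  using assms(1,2,4)
proof (induction I arbitrary: S b rule: finite_psubset_induct)
  case (psubset I)
  show ?case
  proof (cases "\<forall>v\<in>S. \<forall>g. F g v = 0")
    case True
    then have "{v \<in> S. \<forall>g. F g v = 0} = S" by blast
    then show ?thesis using psubset.prems by simp
  next
    case False
    then obtain u h where u: "u \<in> S" "F h u \<noteq> 0" by blast
    obtain a where "F h u = (\<Sum>i\<in>I. a i * b i h)"
      using psubset.prems(2)[OF u(1)] by auto
    \<comment> \<open>A nonzero sum has a nonzero summand, which supplies the pivot
      \<open>b j h\<close>.\<close>
    with u(2) obtain j where "j \<in> I" "a j * b j h \<noteq> 0"
      by (auto elim: sum.not_neutral_contains_not_neutral)
    then have j: "j \<in> I" "b j h \<noteq> 0" by auto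
    define S' where "S' = {v \<in> S. F h v = 0}"
    \<comment> \<open>Gaussian elimination: \<open>c i\<close> is \<open>b i\<close> minus the
      multiple of \<open>b j\<close> that makes it vanish at \<open>h\<close>.\<close>
    define c where "c i g = b i g - b i h / b j h * b j g" for i g
    have "complemented {v \<in> S'. \<forall>g. F g v = 0}"
    proof (rule psubset.IH[of "I - {j}" S' c])
      show "I - {j} \<subset> I" using j by blast
      show "complemented S'"
        unfolding S'_def by (rule complemented_kernel_functional[OF psubset.prems(1) assms(3) u])
      fix v assume v: "v \<in> S'"
      then obtain a where a: "\<And>g. F g v = (\<Sum>i\<in>I. a i * b i g)"
        using psubset.prems(2) by (auto simp: S'_def)
      have split: "F g v = a j * b j g + (\<Sum>i\<in>I - {j}. a i * b i g)" for g
        unfolding a by (rule sum.remove[OF psubset.hyps(1) j(1)])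
      \<comment> \<open>On \<open>S'\<close> the condition at \<open>h\<close> determines
        \<open>a j\<close> from the other coefficients. Substituting it turns each
        \<open>b i\<close> into \<open>c i\<close> and leaves the remaining \<open>a i\<close>
        unchanged.\<close>
      have h: "(\<Sum>i\<in>I - {j}. a i * b i h) = - (a j * b j h)"
        using split[of h] v by (simp add: S'_def)
      have "F g v = (\<Sum>i\<in>I - {j}. a i * c i g)" for g
      proof -
        have "a i * c i g = a i * b i g - a i * b i h * (b j g / b j h)" for i
          by (simp add: c_def right_diff_distrib)
        then have "(\<Sum>i\<in>I - {j}. a i * c i g) =
            (\<Sum>i\<in>I - {j}. a i * b i g) - (\<Sum>i\<in>I - {j}. a i * b i h) * (b j g / b j h)"
          by (simp only: sum_subtractf sum_distrib_right)
        then show ?thesis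
          using j(2) by (simp add: h split)
      qed
      then show "\<exists>a. \<forall>g. F g v = (\<Sum>i\<in>I - {j}. a i * c i g)" by blast
    qed
    moreover have "{v \<in> S'. \<forall>g. F g v = 0} = {v \<in> S. \<forall>g. F g v = 0}"
      by (auto simp: S'_def)
    ultimately show ?thesis by simp
  qed
qed

section \<open>Differences of values of a Lipschitz function modulo constants\<close>

text \<open>Differences of values do not see additive constants, so they descend to the quotient.
  They also separate its elements, which allows computing there without representatives.\<close>

lift_definition lip_diff :: "'x::metric_space \<Rightarrow> 'x \<Rightarrow> 'x lip_mod \<Rightarrow> real" is
  "\<lambda>x y f. f x - f y"
proof -
  fix x y :: 'x and f h :: "'x \<Rightarrow> real"
  assume "lip_rel f h"
  then obtain c where c: "\<And>x. f x - h x = c" by (auto simp: lip_rel_def)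
  show "f x - f y = h x - h y" using c[of x] c[of y] by simp
qed

lemma lip_rel_refl_iff: "lip_rel f f \<longleftrightarrow> f \<in> Lip"
  by (simp add: lip_rel_def)

lemma lip_diff_abs: "f \<in> Lip \<Longrightarrow> lip_diff x y (abs_lip_mod f) = f x - f y"
  by (simp add: lip_diff.abs_eq lip_rel_refl_iff)

lemma lip_diff_linear [simp]:
  "lip_diff x y (\<phi> + \<psi>) = lip_diff x y \<phi> + lip_diff x y \<psi>"
  "lip_diff x y (r *\<^sub>R \<phi>) = r * lip_diff x y \<phi>"
  by (transfer, simp add: algebra_simps)+

lemma lip_diff_cancel: "lip_diff x z \<phi> - lip_diff y z \<phi> = lip_diff x y \<phi>"
  by transfer simp

lemma abs_lip_diff_le: "\<bar>lip_diff x y \<phi>\<bar> \<le> norm \<phi> * dist x y"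
  by transfer (simp add: lip_rel_refl_iff lip_const_upper)

lemma bounded_linear_lip_diff: "bounded_linear (lip_diff x y)"
  by (rule bounded_linear_intro[where K = "dist x y"]) (use abs_lip_diff_le in auto)

lemma lip_mod_eqI:
  assumes "\<And>x y. lip_diff x y \<phi> = lip_diff x y \<psi>"
  shows "\<phi> = \<psi>"
  using assms
proof transfer
  fix f h :: "'a \<Rightarrow> real"
  assume "lip_rel f f" "lip_rel h h" and *: "\<And>x y. f x - f y = h x - h y"
  moreover have "f x - h x = f undefined - h undefined" for x
    using *[of x undefined] by simp
  ultimately show "lip_rel f h" by (auto simp: lip_rel_def)
qed

lemma norm_lip_mod_le:
  assumes "C \<ge> 0" "\<And>x y. \<bar>lip_diff x y \<phi>\<bar> \<le> C * dist x y"
  shows "norm \<phi> \<le> C"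
  using assms by transfer (rule lip_const_least)

text \<open>Comparing \<open>\<phi> - \<phi>(g \<cdot>)\<close> at two points eliminates the unknown
  constant.\<close>

lemma lip_invariant_iff:
  "lip_invariant act \<phi> \<longleftrightarrow> (\<forall>g x y. lip_diff (act g x) (act g y) \<phi> = lip_diff x y \<phi>)"
proof transfer
  fix act :: "'g \<Rightarrow> 'x \<Rightarrow> 'x" and f :: "'x \<Rightarrow> real"
  have "(\<exists>c. \<forall>x. f x - f (act g x) = c) \<longleftrightarrow> (\<forall>x y. f (act g x) - f (act g y) = f x - f y)" for g
  proof
    assume "\<exists>c. \<forall>x. f x - f (act g x) = c"
    then obtain c where c: "\<And>x. f x - f (act g x) = c" by blast
    have "f (act g x) - f (act g y) = f x - f y" for x y
      using c[of x] c[of y] by linarith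
    then show "\<forall>x y. f (act g x) - f (act g y) = f x - f y" by blast
  next
    assume *: "\<forall>x y. f (act g x) - f (act g y) = f x - f y"
    have "f x - f (act g x) = f undefined - f (act g undefined)" for x
      using *[rule_format, of x undefined] by linarith
    then show "\<exists>c. \<forall>x. f x - f (act g x) = c" by blast
  qed
  then show "(\<forall>g. \<exists>c. \<forall>x. f x - f (act g x) = c) \<longleftrightarrow>
      (\<forall>g x y. f (act g x) - f (act g y) = f x - f y)" by simp
qed

text \<open>For invariant \<open>\<phi>\<close> every point \<open>x\<close> yields the same
  constant. The right-hand side is a bounded linear functional on the whole space, to which the
  elimination argument applies.\<close>

lemma lip_R_eq_lip_diff:
  assumes "lip_invariant act \<phi>"
  shows "lip_R act \<phi> g = lip_diff x (act g x) \<phi>"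
  using assms
proof transfer
  fix act :: "'g \<Rightarrow> 'x \<Rightarrow> 'x" and f :: "'x \<Rightarrow> real" and g x
  assume "\<forall>g. \<exists>c. \<forall>x. f x - f (act g x) = c"
  then obtain c where "\<And>x. f x - f (act g x) = c" by blast
  then show "(THE c. \<forall>x. f x - f (act g x) = c) = f x - f (act g x)" by simp
qed

text \<open>As \<open>act 0\<close> is the identity, \<open>x\<close> lies in its own orbit and can
  serve as the reference point there.\<close>

lemma constant_on_orbits_iff:
  fixes act :: "'g::topological_group_add \<Rightarrow> 'x::metric_space \<Rightarrow> 'x"
  assumes "isometric_action act"
  shows "constant_on_orbits act \<phi> \<longleftrightarrow> (\<forall>g x. lip_diff x (act g x) \<phi> = 0)"
  using assms
proof transfer
  fix act :: "'g \<Rightarrow> 'x \<Rightarrow> 'x" and f :: "'x \<Rightarrow> real"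
  assume act: "isometric_action act"
  have "f constant_on (orbit_of act x) \<longleftrightarrow> (\<forall>g. f x - f (act g x) = 0)" for x
  proof
    have "x = act 0 x" using act by (simp add: isometric_action_def)
    then have "x \<in> orbit_of act x" unfolding orbit_of_def by (rule range_eqI)
    moreover assume "f constant_on (orbit_of act x)"
    ultimately have "f (act g x) = f x" for g
      unfolding constant_on_def by (metis orbit_of_def rangeI)
    then show "\<forall>g. f x - f (act g x) = 0" by simp
  qed (auto simp: constant_on_def orbit_of_def)
  then show "(\<forall>x. f constant_on (orbit_of act x)) \<longleftrightarrow> (\<forall>g x. f x - f (act g x) = 0)"
    by blast
qed

text \<open>The functions constant on orbits form the kernel of \<open>R\<close>: they are invariant
  with constant 0, and for an invariant element the constant can be read off at the single point
  \<open>z\<close>.\<close>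

lemma constant_on_orbits_iff_base_point:
  assumes "isometric_action act"
  shows "constant_on_orbits act \<phi> \<longleftrightarrow> lip_invariant act \<phi> \<and> (\<forall>g. lip_diff z (act g z) \<phi> = 0)"
    (is "?L \<longleftrightarrow> ?R")
proof
  assume ?L
  then have *: "lip_diff x (act g x) \<phi> = 0" for g x
    using assms by (simp add: constant_on_orbits_iff)
  have "lip_diff (act g x) (act g y) \<phi> = lip_diff x y \<phi>" for g x y
    using *[of x g] *[of y g] by transfer simp
  with * show ?R by (simp add: lip_invariant_iff)
next
  assume R: ?R
  then have "lip_diff x (act g x) \<phi> = lip_diff z (act g z) \<phi>" for g x
    using lip_R_eq_lip_diff[of act \<phi> g x] lip_R_eq_lip_diff[of act \<phi> g z] by simp
  with R show ?L by (simp add: constant_on_orbits_iff[OF assms])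
qed

section \<open>Averaging with an invariant mean\<close>

text \<open>Boundedness holds because \<open>act g\<close> preserves the distance of
  \<open>x\<close> and \<open>y\<close>. For continuity, \<open>act (k + h) u\<close> is
  \<open>act k\<close> applied to \<open>act h u\<close>, so the left factor \<open>k\<close> drops
  out of all distances and the estimate is uniform in \<open>k\<close>.\<close>

lemma orbit_difference_in_LUCB:
  assumes "isometric_action act" "continuous_action act"
  shows "(\<lambda>g. lip_diff (act g x) (act g y) \<phi>) \<in> LUCB"
proof -
  have iso: "dist (act g u) (act g v) = dist u v" and mult: "act (g + h) u = act g (act h u)"
    for g h u v using assms(1) by (auto simp: isometric_action_def)
  have "\<bar>lip_diff (act g x) (act g y) \<phi>\<bar> \<le> norm \<phi> * dist x y" for g
    using abs_lip_diff_le[of "act g x" "act g y" \<phi>] by (simp add: iso)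
  then have "bounded (range (\<lambda>g. lip_diff (act g x) (act g y) \<phi>))"
    by (auto simp: bounded_iff)
  moreover have "uniform_limit UNIV (\<lambda>h k. lip_diff (act (k + h) x) (act (k + h) y) \<phi>)
      (\<lambda>k. lip_diff (act (k + g) x) (act (k + g) y) \<phi>) (at g)" for g
  proof (rule uniform_limitI)
    fix e :: real assume "0 < e"
    have orb: "((\<lambda>h. act h u) \<longlongrightarrow> act g u) (at g)" for u
    proof -
      have "continuous_on UNIV (\<lambda>h. (\<lambda>(g, x). act g x) (h, u))"
        using assms(2) unfolding continuous_action_def
        by (rule continuous_on_compose2) (auto intro!: continuous_intros)
      then show ?thesis by (simp add: continuous_on_def)
    qed
    let ?D = "\<lambda>h. norm \<phi> * (dist (act h x) (act g x) + dist (act h y) (act g y))"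
    have "(?D \<longlongrightarrow> norm \<phi> * (dist (act g x) (act g x) + dist (act g y) (act g y))) (at g)"
      by (intro tendsto_intros orb)
    then have "(?D \<longlongrightarrow> 0) (at g)" by simp
    then have "\<forall>\<^sub>F h in at g. ?D h < e"
      using \<open>0 < e\<close> by (rule order_tendstoD(2))
    then show "\<forall>\<^sub>F h in at g. \<forall>k\<in>UNIV. dist (lip_diff (act (k + h) x) (act (k + h) y) \<phi>)
        (lip_diff (act (k + g) x) (act (k + g) y) \<phi>) < e"
    proof (rule eventually_mono, intro ballI)
      fix h k assume less: "?D h < e"
      \<comment> \<open>The four values are regrouped so that each difference compares two points of
        the same orbit, which are close when \<open>h\<close> is near \<open>g\<close>.\<close>
      have "lip_diff (act (k + h) x) (act (k + h) y) \<phi> - lip_diff (act (k + g) x) (act (k + g) y) \<phi>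
          = lip_diff (act (k + h) x) (act (k + g) x) \<phi> - lip_diff (act (k + h) y) (act (k + g) y) \<phi>"
        by transfer simp
      moreover have "\<bar>lip_diff (act (k + h) u) (act (k + g) u) \<phi>\<bar> \<le> norm \<phi> * dist (act h u) (act g u)"
        for u using abs_lip_diff_le[of "act (k + h) u" "act (k + g) u" \<phi>] by (simp add: mult iso)
      from this[of x] this[of y] have
        "\<bar>lip_diff (act (k + h) x) (act (k + g) x) \<phi> - lip_diff (act (k + h) y) (act (k + g) y) \<phi>\<bar> \<le> ?D h"
        unfolding distrib_left by linarith
      ultimately show "dist (lip_diff (act (k + h) x) (act (k + h) y) \<phi>)
        (lip_diff (act (k + g) x) (act (k + g) y) \<phi>) < e"
        using less by (simp add: dist_real_def)
    qed
  qed
  ultimately show ?thesis by (simp add: LUCB_def)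
qed

lemma const_in_LUCB: "(\<lambda>_. c) \<in> LUCB"
  unfolding LUCB_def by (auto intro!: uniform_limitI)

lemma mean_add:
  assumes "mean m" "\<phi> \<in> LUCB" "\<psi> \<in> LUCB"
  shows "m (\<lambda>x. \<phi> x + \<psi> x) = m \<phi> + m \<psi>"
  using assms(1)[unfolded mean_def, THEN conjunct1, rule_format, OF assms(2,3)] .

lemma mean_cmult:
  assumes "mean m" "\<phi> \<in> LUCB"
  shows "m (\<lambda>x. c * \<phi> x) = c * m \<phi>"
  using assms(1)[unfolded mean_def, THEN conjunct2, THEN conjunct1, rule_format, OF assms(2)] .

lemma mean_const:
  assumes "mean m"
  shows "m (\<lambda>_. c) = c"
proof -
  have "m (\<lambda>_. 1) = 1"
    using assms unfolding mean_def by (elim conjE)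
  then show ?thesis
    using mean_cmult[OF assms const_in_LUCB[of 1], of c] by simp
qed

text \<open>Additivity is applied to \<open>\<phi> = (\<phi> - \<psi>) + \<psi>\<close>. In the
  application the difference is again an orbit difference, so its membership in \<open>LUCB\<close>
  is at hand.\<close>

lemma mean_diff:
  assumes "mean m" "\<phi> \<in> LUCB" "\<psi> \<in> LUCB" "(\<lambda>x. \<phi> x - \<psi> x) \<in> LUCB"
  shows "m (\<lambda>x. \<phi> x - \<psi> x) = m \<phi> - m \<psi>"
  using mean_add[OF assms(1,4,3)] by simp

lemma abs_mean_le:
  assumes "mean m" "\<phi> \<in> LUCB" "\<And>x. \<bar>\<phi> x\<bar> \<le> C"
  shows "\<bar>m \<phi>\<bar> \<le> C"
proof -
  have "\<bar>m \<phi>\<bar> \<le> (SUP x. \<bar>\<phi> x\<bar>)"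
    using assms(1)[unfolded mean_def, THEN conjunct2, THEN conjunct2, THEN conjunct2, THEN conjunct1,
        rule_format, OF assms(2)] .
  also have "\<dots> \<le> C" using assms(3) by (intro cSUP_least) auto
  finally show ?thesis .
qed

text \<open>Differences are averaged rather than \<open>\<phi>\<close> itself, since
  \<open>\<phi>\<close> may be unbounded on an orbit.\<close>

lemma complemented_lip_invariant:
  fixes act :: "'g::topological_group_add \<Rightarrow> 'x::metric_space \<Rightarrow> 'x"
  assumes amen: "amenable TYPE('g)" and act: "isometric_action act" "continuous_action act"
  shows "complemented {\<phi>. lip_invariant act \<phi>}"
proof -
  from amen obtain m :: "('g \<Rightarrow> real) \<Rightarrow> real"
    where m: "mean m" and m_inv: "\<And>g \<phi>. \<phi> \<in> LUCB \<Longrightarrow> m (\<lambda>x. \<phi> (x + g)) = m \<phi>"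
    by (auto simp: amenable_def)
  note L = orbit_difference_in_LUCB[OF act]
  define A where "A x y \<phi> = m (\<lambda>g. lip_diff (act g x) (act g y) \<phi>)" for x y \<phi>
  have A_le: "\<bar>A x y \<phi>\<bar> \<le> norm \<phi> * dist x y" for x y \<phi>
    unfolding A_def
  proof (rule abs_mean_le[OF m L])
    fix g
    show "\<bar>lip_diff (act g x) (act g y) \<phi>\<bar> \<le> norm \<phi> * dist x y"
      using abs_lip_diff_le[of "act g x" "act g y" \<phi>] act(1) by (simp add: isometric_action_def)
  qed
  \<comment> \<open>This cocycle identity makes \<open>A x y \<phi>\<close> the difference of values
    of the single function \<open>x \<mapsto> A x z \<phi>\<close>.\<close>
  have A_cancel: "A x z \<phi> - A y z \<phi> = A x y \<phi>" for x y z \<phi>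
    unfolding A_def using mean_diff[OF m L[of x z \<phi>] L[of y z \<phi>]] L by (simp add: lip_diff_cancel)
  define z :: 'x where "z = undefined"
  define P where "P \<phi> = abs_lip_mod (\<lambda>x. A x z \<phi>)" for \<phi>
  have "(\<lambda>x. A x z \<phi>) \<in> Lip" for \<phi>
    by (rule LipI[where C = "norm \<phi>"]) (simp add: A_cancel A_le)
  then have P_diff: "lip_diff x y (P \<phi>) = A x y \<phi>" for x y \<phi>
    by (simp add: P_def lip_diff_abs A_cancel)
  \<comment> \<open>For invariant \<open>\<phi>\<close> the averaged function of \<open>g\<close> is
    constant.\<close>
  have P_fix: "P \<phi> = \<phi>" if "lip_invariant act \<phi>" for \<phi>
    using that by (intro lip_mod_eqI) (simp add: P_diff A_def lip_invariant_iff mean_const[OF m])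
  have P_inv: "lip_invariant act (P \<phi>)" for \<phi>
    unfolding lip_invariant_iff P_diff
  proof (intro allI)
    fix g x y
    \<comment> \<open>Moving both points by \<open>g\<close> translates the averaged function by
      \<open>g\<close> on the right, and the mean is invariant under right translation.\<close>
    show "A (act g x) (act g y) \<phi> = A x y \<phi>"
      using m_inv[OF L[of x y \<phi>], of g] act(1) by (simp add: A_def isometric_action_def)
  qed
  have "bounded_linear P"
  proof (rule bounded_linear_intro[where K = 1])
    show "P (\<phi> + \<psi>) = P \<phi> + P \<psi>" for \<phi> \<psi>
      by (intro lip_mod_eqI) (simp add: P_diff A_def mean_add[OF m L L])
    show "P (r *\<^sub>R \<phi>) = r *\<^sub>R P \<phi>" for r \<phi>
      by (intro lip_mod_eqI) (simp add: P_diff A_def mean_cmult[OF m L])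
    show "norm (P \<phi>) \<le> norm \<phi> * 1" for \<phi>
      using A_le by (intro norm_lip_mod_le) (simp_all add: P_diff)
  qed
  moreover have "P (P \<phi>) = P \<phi>" for \<phi>
    by (rule P_fix[OF P_inv])
  moreover have "range P = {\<phi>. lip_invariant act \<phi>}"
    by (auto simp: P_inv intro: range_eqI P_fix[symmetric])
  ultimately show ?thesis
    by (rule complemented_projection[where P = P])
qed

theorem theorem10p1:
  fixes act :: "'g::topological_group_add \<Rightarrow> 'x::metric_space \<Rightarrow> 'x"
  assumes "amenable TYPE('g)"
    and "isometric_action act" and "continuous_action act"
    and "finite_rank {\<phi>. lip_invariant act \<phi>} Hom_real (lip_R act)"
  shows "complemented {\<phi> :: 'x lip_mod. constant_on_orbits act \<phi>}"
proof -
  define z :: 'x where "z = undefined"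
  obtain B where B: "finite B"
    "\<And>\<phi>. lip_invariant act \<phi> \<Longrightarrow> \<exists>a. \<forall>g. lip_R act \<phi> g = (\<Sum>b\<in>B. a b * b g)"
    using assms(4) by (auto simp: finite_rank_def)
  have "complemented {\<phi> \<in> {\<phi>. lip_invariant act \<phi>}. \<forall>g. lip_diff z (act g z) \<phi> = 0}"
  \<comment> \<open>The finite set \<open>B\<close> of homomorphisms serves as its own index
    set.\<close>
  proof (rule complemented_common_kernel[OF B(1), where b = "\<lambda>b. b"])
    show "complemented {\<phi>. lip_invariant act \<phi>}"
      by (rule complemented_lip_invariant[OF assms(1-3)])
    show "bounded_linear (lip_diff z (act g z))" for g
      by (rule bounded_linear_lip_diff)
    show "\<exists>a. \<forall>g. lip_diff z (act g z) \<phi> = (\<Sum>b\<in>B. a b * b g)"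
      if "\<phi> \<in> {\<phi>. lip_invariant act \<phi>}" for \<phi>
      using that B(2)[of \<phi>] by (simp add: lip_R_eq_lip_diff[of act \<phi> _ z])
  qed
  then show ?thesis
    by (simp add: constant_on_orbits_iff_base_point[OF assms(2), of _ z])
qed

end
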